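(* Let $A$ be a finite-dimensional unital associative algebra over a field $F$, and let $a$ be an $n\times n$ matrix of linear mappings of $A$ that has a ${}_\circ{}^\circ$-inverse matrix $a^{-1}$. Then the matrices $\det(a,{}_\circ{}^\circ)$ (where its entries are defined) and $a^{-1}$ are matrices of linear mappings of $A$.
   Context: A linear mapping of $A$ is a mapping $A\to A$ of the form $x\mapsto\sum_s a_s x b_s$ (finite sum, $a_s,b_s\in A$), i.e. the mapping given by $\sum_s a_s\otimes b_s\in A\otimes_F A$ via $(a\otimes b)\circ x=axb$. A functional matrix is a matrix whose entries are arbitrary mappings $A\to A$, with entries $f^i_j$ ($i$ row, $j$ column); it is a matrix of linear mappings if all entries are linear mappings of $A$. The ${}_\circ{}^\circ$-product is $(b\,{}_\circ{}^\circ\, c)^i_j=\sum_k b^i_k\circ c^k_j$, with $\circ$ composition. $\delta$ is the identity matrix (identity mapping on the diagonal, zero mapping elsewhere); the inverse of a square matrix $a$ is a functional matrix $a^{-1}$ with $a\,{}_\circ{}^\circ\, a^{-1}=\delta$. The Hadamard inverse is $(\mathcal H m)^j_i=(m^i_j)^{-1}$ (inverse mapping, rows and columns exchanged), defined where $m^i_j$ is invertible. The quasideterminant $\det(a,{}_\circ{}^\circ)$ is the matrix with entries $\det(a,{}_\circ{}^\circ)^i_j=(\mathcal H a^{-1})^i_j$, defined where the corresponding entry of $a^{-1}$ is invertible. *)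

theory Defs
  imports "HOL-Analysis.Finite_Cartesian_Product"
begin

text \<open>
  The sort \<open>{ring, monoid_mult}\<close> is that of unital associative rings; unlike \<open>ring_1\<close> it does not
  exclude the zero ring.
\<close>

locale finite_dimensional_algebra = vector_space scale
  for scale :: "'f::field \<Rightarrow> 'a::{ring, monoid_mult} \<Rightarrow> 'a" +
  assumes mult_scale_left: "scale c x * y = scale c (x * y)"
    and mult_scale_right: "x * scale c y = scale c (x * y)"
    and finite_dimensional: "\<exists>B. finite B \<and> span B = UNIV"

text \<open>
  The mapping given by the tensor \<open>\<Sum>s. a s \<otimes> b s\<close>. This is more restrictive than linearity over
  the base field: not every linear endomorphism of the algebra has this form.
\<close>

definition linear_mapping :: "('a::{ring, monoid_mult} \<Rightarrow> 'a) \<Rightarrow> bool" where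
  "linear_mapping f \<longleftrightarrow>
     (\<exists>(m::nat) (a :: nat \<Rightarrow> 'a) (b :: nat \<Rightarrow> 'a). f = (\<lambda>x. \<Sum>s<m. a s * x * b s))"

text \<open>Square functional matrices; the entry in row \<open>i\<close> and column \<open>j\<close> is \<open>m $ i $ j\<close>.\<close>

type_synonym ('a, 'n) functional_matrix = "('a \<Rightarrow> 'a) ^ 'n ^ 'n"

definition matrix_of_linear_mappings ::
    "('a::{ring, monoid_mult}, 'n::finite) functional_matrix \<Rightarrow> bool" where
  "matrix_of_linear_mappings m \<longleftrightarrow> (\<forall>i j. linear_mapping (m $ i $ j))"

definition circ_product ::
    "('a::{ring, monoid_mult}, 'n::finite) functional_matrix \<Rightarrow> ('a, 'n) functional_matrix
      \<Rightarrow> ('a, 'n) functional_matrix" where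
  "circ_product b c = (\<chi> i j. (\<lambda>x. \<Sum>k\<in>UNIV. (b $ i $ k \<circ> c $ k $ j) x))"

definition identity_matrix :: "('a::{ring, monoid_mult}, 'n::finite) functional_matrix" where
  "identity_matrix = (\<chi> i j. if i = j then id else (\<lambda>x. 0))"

text \<open>The entries of an inverse matrix are arbitrary mappings, and only one side is required.\<close>

definition is_circ_inverse ::
    "('a::{ring, monoid_mult}, 'n::finite) functional_matrix \<Rightarrow> ('a, 'n) functional_matrix
      \<Rightarrow> bool" where
  "is_circ_inverse a b \<longleftrightarrow> circ_product a b = identity_matrix"

text \<open>Undefined entries of the Hadamard inverse are \<open>None\<close>.\<close>

definition hadamard_inverse ::
    "('a, 'n::finite) functional_matrix \<Rightarrow> ('a \<Rightarrow> 'a) option ^ 'n ^ 'n" where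
  "hadamard_inverse m =
     (\<chi> j i. if bij (m $ i $ j) then Some (inv (m $ i $ j)) else None)"

text \<open>
  A relation, because an inverse of an arbitrary functional matrix need not exist or be unique.
\<close>

definition is_quasideterminant ::
    "('a::{ring, monoid_mult}, 'n::finite) functional_matrix \<Rightarrow> ('a \<Rightarrow> 'a) option ^ 'n ^ 'n
      \<Rightarrow> bool" where
  "is_quasideterminant a d \<longleftrightarrow> (\<exists>b. is_circ_inverse a b \<and> d = hadamard_inverse b)"

end

theory Submission
  imports Defs "HOL-Library.Function_Algebras"
begin

text \<open>
  The linear mappings form a subring of the ring of all additive mappings of \<open>A\<close>, and over the
  base field they span a finite-dimensional space, being spanned by the mappings \<open>x \<mapsto> p x q\<close> with
  \<open>p, q\<close> from a finite spanning set of \<open>A\<close>. Hence the matrices of linear mappings form a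
  finite-dimensional space \<open>R\<close> that contains \<open>\<delta>\<close> and is closed under the product
  (lemmas \<open>matrix_of_linear_mappings_circ_product\<close> and \<open>finite_span_linear_mapping_matrices\<close>).

  Let \<open>a \<in> R\<close> and \<open>a b = \<delta>\<close>, where the entries of \<open>b\<close> are arbitrary mappings. The map
  \<open>r \<mapsto> r a\<close> of \<open>R\<close> into itself is linear, and it is injective, because \<open>r a b = r\<close>. By finite
  dimension it is onto, so \<open>p a = \<delta>\<close> for some \<open>p \<in> R\<close>. Then \<open>p = p a b = b\<close>, so \<open>b \<in> R\<close>.

  A defined entry of a quasideterminant is the inverse of a bijective entry of some such \<open>b\<close>, which
  is a linear mapping. That its inverse is a linear mapping is the same result for matrices of
  size one.
\<close>

section \<open>Linear mappings\<close>

lemma linear_mapping_sum_finite: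
  fixes a b :: "'s \<Rightarrow> 'a::{ring, monoid_mult}"
  assumes "finite S"
  shows "linear_mapping (\<lambda>x. \<Sum>s\<in>S. a s * x * b s)"
proof -
  obtain h where h: "bij_betw h {0..<card S} S"
    using ex_bij_betw_nat_finite[OF assms] by blast
  have "(\<lambda>x. \<Sum>s\<in>S. a s * x * b s) = (\<lambda>x. \<Sum>k<card S. (a \<circ> h) k * x * (b \<circ> h) k)"
    by (simp add: sum.reindex_bij_betw[OF h, symmetric] atLeast0LessThan)
  then show ?thesis unfolding linear_mapping_def by blast
qed

lemma linear_mapping_zero: "linear_mapping (\<lambda>x. 0)"
  using linear_mapping_sum_finite[of "{} :: nat set"] by simp

lemma linear_mapping_sandwich: "linear_mapping (\<lambda>x. p * x * q)"
  using linear_mapping_sum_finite[of "{()}" "\<lambda>_. p" "\<lambda>_. q"] by simp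

lemma linear_mapping_id: "linear_mapping id"
  using linear_mapping_sandwich[of 1 1] by (simp add: id_def)

lemma linear_mapping_add:
  assumes "linear_mapping f" "linear_mapping g"
  shows "linear_mapping (\<lambda>x. f x + g x)"
proof -
  obtain m a b where f: "f = (\<lambda>x. \<Sum>s<m::nat. a s * x * b s)"
    using assms(1) unfolding linear_mapping_def by blast
  obtain n c d where g: "g = (\<lambda>x. \<Sum>s<n::nat. c s * x * d s)"
    using assms(2) unfolding linear_mapping_def by blast
  have "linear_mapping (\<lambda>x. \<Sum>s\<in>{..<m} <+> {..<n}. case_sum a c s * x * case_sum b d s)"
    by (rule linear_mapping_sum_finite) simp
  then show ?thesis by (simp add: sum.Plus f g comp_def)
qed

lemma linear_mapping_sum:
  assumes "\<And>k. k \<in> K \<Longrightarrow> linear_mapping (f k)"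
  shows "linear_mapping (\<lambda>x. \<Sum>k\<in>K. f k x)"
  using assms
  by (induction K rule: infinite_finite_induct)
    (simp_all add: linear_mapping_zero linear_mapping_add)

lemma linear_mapping_comp:
  assumes "linear_mapping f" "linear_mapping g"
  shows "linear_mapping (f \<circ> g)"
proof -
  obtain m a b where f: "f = (\<lambda>x. \<Sum>s<m::nat. a s * x * b s)"
    using assms(1) unfolding linear_mapping_def by blast
  obtain n c d where g: "g = (\<lambda>x. \<Sum>s<n::nat. c s * x * d s)"
    using assms(2) unfolding linear_mapping_def by blast
  have "f \<circ> g = (\<lambda>x. \<Sum>s<m. \<Sum>t<n. (a s * c t) * x * (d t * b s))"
    by (simp add: f g fun_eq_iff sum_distrib_left sum_distrib_right mult.assoc)
  then show ?thesis
    by (simp add: linear_mapping_sum linear_mapping_sandwich)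
qed

lemma additive_linear_mapping: "linear_mapping f \<Longrightarrow> additive f"
  unfolding linear_mapping_def
  by (auto simp: additive_def distrib_left distrib_right sum.distrib)

section \<open>The product of functional matrices\<close>

lemma circ_product_component:
  "circ_product b c $ i $ j = (\<lambda>x. \<Sum>k\<in>UNIV. (b $ i $ k) ((c $ k $ j) x))"
  by (simp add: circ_product_def)

lemma identity_matrix_component:
  "identity_matrix $ i $ j = (if i = j then id else (\<lambda>x. 0))"
  by (simp add: identity_matrix_def)

lemma matrix_of_linear_mappings_identity: "matrix_of_linear_mappings identity_matrix"
  by (simp add: matrix_of_linear_mappings_def identity_matrix_component
      linear_mapping_id linear_mapping_zero)

lemma matrix_of_linear_mappings_circ_product:
  assumes "matrix_of_linear_mappings b" "matrix_of_linear_mappings c"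
  shows "matrix_of_linear_mappings (circ_product b c)"
proof -
  have "linear_mapping (b $ i $ k \<circ> c $ k $ j)" for i j k
    using assms by (intro linear_mapping_comp) (simp_all add: matrix_of_linear_mappings_def)
  then show ?thesis
    by (simp add: matrix_of_linear_mappings_def circ_product_component linear_mapping_sum comp_def)
qed

text \<open>
  Composition distributes over sums on its right only for additive outer mappings, so the
  associative law needs the first factor to be a matrix of linear mappings. The other two factors
  may be arbitrary, which is what allows cancelling an inverse matrix with arbitrary entries.
\<close>

lemma circ_product_assoc:
  assumes "matrix_of_linear_mappings r"
  shows "circ_product (circ_product r a) b = circ_product r (circ_product a b)"
proof -
  have *: "(r $ i $ k) (\<Sum>l\<in>UNIV. h l) = (\<Sum>l\<in>UNIV. (r $ i $ k) (h l))" for i k and h :: "'b \<Rightarrow> 'a"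
    using assms additive.sum[OF additive_linear_mapping, of "r $ i $ k" h UNIV]
    by (simp add: matrix_of_linear_mappings_def)
  show ?thesis
    by (simp add: vec_eq_iff circ_product_component * fun_eq_iff) (intro allI sum.swap)
qed

lemma circ_product_identity_left: "circ_product identity_matrix b = b"
proof -
  have "(identity_matrix $ i $ k) y = (if i = k then y else 0)" for i k :: 'b and y :: 'a
    by (simp add: identity_matrix_component)
  then show ?thesis by (simp add: vec_eq_iff circ_product_component)
qed

lemma circ_product_identity_right:
  assumes "matrix_of_linear_mappings r"
  shows "circ_product r identity_matrix = r"
proof -
  have "(r $ i $ k) 0 = 0" for i k
    using assms additive.zero[OF additive_linear_mapping, of "r $ i $ k"]
    by (simp add: matrix_of_linear_mappings_def)
  then have "(r $ i $ k) ((identity_matrix $ k $ j) x) = (if k = j then (r $ i $ k) x else 0)" for i k j x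
    by (simp add: identity_matrix_component)
  then show ?thesis by (simp add: vec_eq_iff circ_product_component)
qed

section \<open>The space of matrices of linear mappings\<close>

text \<open>
  The statement is about a subspace because the space of all functional matrices, to which it will be
  applied, is in general not finite-dimensional. The image of a basis is an independent set with as many elements as the basis, so a further
  vector of the subspace outside the image would make an independent set that is too large.
\<close>

lemma (in vector_space) inj_on_imp_surj_on_subspace:
  assumes f: "Vector_Spaces.linear scale scale f"
    and V: "subspace V" "finite B" "V \<subseteq> span B"
    and into: "f ` V \<subseteq> V" and inj: "inj_on f V"
  shows "f ` V = V"
proof (rule ccontr)
  interpret vector_space_pair scale scale by unfold_locales
  assume "f ` V \<noteq> V"
  then obtain v where v: "v \<in> V" "v \<notin> f ` V" using into by blast
  obtain C where C: "C \<subseteq> V" "independent C" "V \<subseteq> span C"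
    using maximal_independent_subset by blast
  have VC: "span C = V" by (intro antisym C span_minimal V)
  have "finite C" using independent_span_bound[OF V(2) C(2)] C(1) V(3) by blast
  have "independent (f ` C)"
    by (rule linear_independent_injective_image[OF f]) (use C inj VC in auto)
  moreover have "span (f ` C) = f ` V"
    using linear_span_image[OF f, of C] VC by simp
  ultimately have "independent (insert v (f ` C))"
    using v by (intro independent_insertI) auto
  moreover have "insert v (f ` C) \<subseteq> span C" using v VC C(1) into by blast
  ultimately have "card (insert v (f ` C)) \<le> card C"
    using independent_span_bound[OF \<open>finite C\<close>] by blast
  moreover have "card (f ` C) = card C" using inj C(1) by (meson card_image inj_on_subset)
  moreover have "v \<notin> f ` C" using v C(1) by blast
  ultimately show False using \<open>finite C\<close> by simp
qed

definition single_entry :: "'n \<Rightarrow> 'n \<Rightarrow> ('a \<Rightarrow> 'a::zero) \<Rightarrow> ('a, 'n::finite) functional_matrix" where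
  "single_entry i j f = (\<chi> k l. if k = i \<and> l = j then f else 0)"

lemma sum_fun_apply: "(\<Sum>s\<in>S. f s) x = (\<Sum>s\<in>S. f s (x :: 'b) :: 'c::comm_monoid_add)"
  by (induction S rule: infinite_finite_induct) auto

lemma single_entry_sum:
  fixes f :: "'s \<Rightarrow> 'a \<Rightarrow> 'a::comm_monoid_add"
  shows "single_entry i j (\<lambda>x. \<Sum>s\<in>S. f s x) = (\<Sum>s\<in>S. single_entry i j (f s))"
  by (auto simp: single_entry_def vec_eq_iff fun_eq_iff sum_fun_apply)

lemma matrix_eq_sum_single_entry:
  fixes m :: "('a::comm_monoid_add, 'n::finite) functional_matrix"
  shows "m = (\<Sum>i\<in>UNIV. \<Sum>j\<in>UNIV. single_entry i j (m $ i $ j))"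
proof -
  have "single_entry i j (m $ i $ j) $ k $ l = (if k = i then if l = j then m $ k $ l else 0 else 0)"
    for i j k l by (simp add: single_entry_def)
  then have "(\<Sum>i\<in>UNIV. \<Sum>j\<in>UNIV. single_entry i j (m $ i $ j)) $ k $ l = m $ k $ l" for k l
    by simp (subst sum.swap, simp)
  then show ?thesis by (simp add: vec_eq_iff)
qed

context finite_dimensional_algebra
begin

definition matrix_scale ::
    "'f \<Rightarrow> ('a, 'n::finite) functional_matrix \<Rightarrow> ('a, 'n) functional_matrix" where
  "matrix_scale c m = (\<chi> i j. (\<lambda>x. scale c ((m $ i $ j) x)))"

lemma vector_space_matrix_scale: "vector_space matrix_scale"
  by unfold_locales
    (auto simp: matrix_scale_def vec_eq_iff fun_eq_iff scale_right_distrib scale_left_distrib)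

text \<open>Scalars act through multiplication by the scalar multiples of the unit.\<close>

lemma linear_mapping_scale:
  assumes "linear_mapping f"
  shows "linear_mapping (\<lambda>x. scale c (f x))"
proof -
  have "(\<lambda>x. scale c (f x)) = (\<lambda>x. scale c 1 * x * 1) \<circ> f"
    by (simp add: fun_eq_iff mult_scale_left)
  then show ?thesis using linear_mapping_comp[OF linear_mapping_sandwich assms] by metis
qed

lemma subspace_linear_mapping_matrices:
  "module.subspace matrix_scale (Collect matrix_of_linear_mappings)"
proof -
  interpret mat: vector_space matrix_scale by (rule vector_space_matrix_scale)
  show ?thesis
    by (auto simp: mat.subspace_def matrix_of_linear_mappings_def matrix_scale_def zero_fun_def
        plus_fun_def linear_mapping_zero linear_mapping_scale intro: linear_mapping_add)
qed

text \<open>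
  The spanning set consists of the matrices whose entries are zero except for one \<open>x \<mapsto> p x q\<close>, where \<open>p\<close> and
  \<open>q\<close> range over a finite spanning set of the algebra: such a matrix depends linearly on \<open>p\<close> and on
  \<open>q\<close>.
\<close>

lemma finite_span_linear_mapping_matrices:
  "\<exists>G. finite G \<and>
    Collect matrix_of_linear_mappings
      \<subseteq> module.span matrix_scale (G :: ('a, 'n::finite) functional_matrix set)"
proof -
  interpret mat: vector_space "matrix_scale :: _ \<Rightarrow> ('a, 'n) functional_matrix \<Rightarrow> _"
    by (rule vector_space_matrix_scale)
  interpret vector_space_pair scale "matrix_scale :: _ \<Rightarrow> ('a, 'n) functional_matrix \<Rightarrow> _" ..
  obtain B where B: "finite B" "span B = UNIV" using finite_dimensional by blast
  define E where "E i j p q = single_entry i j (\<lambda>x. p * x * q)" for i j :: 'n and p q :: 'a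
  define G where "G = (\<lambda>(i, j, p, q). E i j p q) ` (UNIV \<times> UNIV \<times> B \<times> B)"
  have spanI: "h p \<in> mat.span G"
    if "Vector_Spaces.linear scale matrix_scale h" "\<And>b. b \<in> B \<Longrightarrow> h b \<in> mat.span G" for h p
  proof -
    have "h p \<in> mat.span (h ` B)" using linear_span_image[OF that(1), of B] B(2) by blast
    then show ?thesis using mat.span_minimal[of "h ` B" "mat.span G"] that(2) by auto
  qed
  have E_left: "Vector_Spaces.linear scale matrix_scale (\<lambda>p. E i j p q)" for i j q
    by unfold_locales
      (auto simp: E_def single_entry_def matrix_scale_def vec_eq_iff fun_eq_iff distrib_right
        mult_scale_left)
  have E_right: "Vector_Spaces.linear scale matrix_scale (E i j p)" for i j p
    by unfold_locales
      (auto simp: E_def single_entry_def matrix_scale_def vec_eq_iff fun_eq_iff distrib_left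
        mult_scale_right)
  have E_base: "E i j p q \<in> mat.span G" if "p \<in> B" "q \<in> B" for i j p q
    using that by (intro mat.span_base) (force simp: G_def)
  have "E i j p q \<in> mat.span G" if "p \<in> B" for i j p q
    by (rule spanI[OF E_right]) (rule E_base[OF that])
  then have E: "E i j p q \<in> mat.span G" for i j p q
    by (rule spanI[OF E_left])
  have "m \<in> mat.span G" if "matrix_of_linear_mappings m" for m :: "('a, 'n) functional_matrix"
  proof -
    have "single_entry i j (m $ i $ j) \<in> mat.span G" for i j
    proof -
      have "linear_mapping (m $ i $ j)"
        using that by (simp add: matrix_of_linear_mappings_def)
      then obtain n a b where "m $ i $ j = (\<lambda>x. \<Sum>s<n::nat. a s * x * b s)"
        unfolding linear_mapping_def by blast
      then have "single_entry i j (m $ i $ j) = (\<Sum>s<n. E i j (a s) (b s))"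
        by (simp add: single_entry_sum E_def)
      then show ?thesis by (simp add: mat.span_sum E)
    qed
    then show ?thesis by (subst matrix_eq_sum_single_entry[of m]) (intro mat.span_sum)
  qed
  moreover have "finite G" using B by (simp add: G_def)
  ultimately show ?thesis by blast
qed

section \<open>Inverse matrices\<close>

text \<open>
  Multiplication by \<open>a\<close> on the right, not on the left, is the map to study, because on matrices of
  linear mappings it is undone by multiplication by the right inverse \<open>b\<close>. So it is injective, hence
  onto, and the left inverse of \<open>a\<close> found in this way must be \<open>b\<close>.
\<close>

theorem matrix_of_linear_mappings_circ_inverse:
  fixes a b :: "('a, 'n::finite) functional_matrix"
  assumes a: "matrix_of_linear_mappings a" and ab: "is_circ_inverse a b"
  shows "matrix_of_linear_mappings b"
proof -
  let ?R = "Collect matrix_of_linear_mappings :: ('a, 'n) functional_matrix set"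
  interpret mat: vector_space "matrix_scale :: _ \<Rightarrow> ('a, 'n) functional_matrix \<Rightarrow> _"
    by (rule vector_space_matrix_scale)
  have cancel: "circ_product (circ_product r a) b = r" if "r \<in> ?R" for r
    using that ab by (simp add: is_circ_inverse_def circ_product_assoc circ_product_identity_right)
  obtain G where G: "finite G" "?R \<subseteq> mat.span G"
    using finite_span_linear_mapping_matrices by blast
  have "(\<lambda>r. circ_product r a) ` ?R = ?R"
  proof (rule mat.inj_on_imp_surj_on_subspace[OF _ subspace_linear_mapping_matrices G])
    show "Vector_Spaces.linear matrix_scale matrix_scale (\<lambda>r. circ_product r a)"
      by unfold_locales
        (auto simp: vec_eq_iff fun_eq_iff circ_product_component matrix_scale_def sum.distrib
          scale_sum_right)
    show "(\<lambda>r. circ_product r a) ` ?R \<subseteq> ?R"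
      using a by (auto intro: matrix_of_linear_mappings_circ_product)
    show "inj_on (\<lambda>r. circ_product r a) ?R"
      by (rule inj_on_inverseI) (rule cancel)
  qed
  then have "identity_matrix \<in> (\<lambda>r. circ_product r a) ` ?R"
    by (simp add: matrix_of_linear_mappings_identity)
  then obtain p where p: "p \<in> ?R" "circ_product p a = identity_matrix"
    by fastforce
  have "p = b" using cancel[OF p(1)] by (simp add: p(2) circ_product_identity_left)
  then show ?thesis using p(1) by simp
qed

text \<open>A mapping is a matrix of size one, and there the product of matrices is composition.\<close>

corollary linear_mapping_right_inverse:
  fixes f g :: "'a \<Rightarrow> 'a"
  assumes "linear_mapping g" "g \<circ> f = id"
  shows "linear_mapping f"
proof -
  have "matrix_of_linear_mappings ((\<chi> i j. f) :: ('a, unit) functional_matrix)"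
  proof (rule matrix_of_linear_mappings_circ_inverse)
    show "matrix_of_linear_mappings ((\<chi> i j. g) :: ('a, unit) functional_matrix)"
      using assms(1) by (simp add: matrix_of_linear_mappings_def)
    show "is_circ_inverse (\<chi> i j. g) ((\<chi> i j. f) :: ('a, unit) functional_matrix)"
      using assms(2)
      by (simp add: is_circ_inverse_def vec_eq_iff circ_product_component
          identity_matrix_component fun_eq_iff UNIV_unit)
  qed
  then show ?thesis by (simp add: matrix_of_linear_mappings_def)
qed

end

theorem theorem7p6:
  fixes scale :: "'f::field \<Rightarrow> 'a::{ring, monoid_mult} \<Rightarrow> 'a"
    and a a_inv :: "('a, 'n::finite) functional_matrix"
  assumes "finite_dimensional_algebra scale"
    and "matrix_of_linear_mappings a"
    and "is_circ_inverse a a_inv"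
  shows "(\<forall>d. is_quasideterminant a d \<longrightarrow>
            (\<forall>i j f. d $ i $ j = Some f \<longrightarrow> linear_mapping f)) \<and>
         matrix_of_linear_mappings a_inv"
proof -
  interpret finite_dimensional_algebra scale by (rule assms(1))
  have "linear_mapping f" if "is_quasideterminant a d" "d $ i $ j = Some f" for d i j f
  proof -
    obtain b where b: "is_circ_inverse a b" "d = hadamard_inverse b"
      using \<open>is_quasideterminant a d\<close> unfolding is_quasideterminant_def by blast
    (* rows and columns are exchanged by the Hadamard inverse *)
    have f: "bij (b $ j $ i)" "f = inv (b $ j $ i)"
      using that(2) unfolding b(2) by (auto simp: hadamard_inverse_def split: if_splits)
    have "linear_mapping (b $ j $ i)"
      using matrix_of_linear_mappings_circ_inverse[OF assms(2) b(1)]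
      by (simp add: matrix_of_linear_mappings_def)
    moreover have "b $ j $ i \<circ> f = id"
      unfolding f(2) using f(1) by (metis bij_is_surj surj_iff)
    ultimately show ?thesis by (rule linear_mapping_right_inverse)
  qed
  then show ?thesis
    using matrix_of_linear_mappings_circ_inverse[OF assms(2,3)] by blast
qed

end
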